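(* Let $1<p<\infty$ and let $D=\{D_1,D_2,\dots,D_n\}\subset(\mathcal{D},W_p)$ be a finite set of persistence diagrams. Then for every $\epsilon>0$ there exists an $\epsilon$-quasi-isometric embedding $f\colon D\to\mathcal{P}_p(\mathbb{R}^2)$, i.e. a map with $$W_p(D_i,D_j)-\epsilon\le W_p(f(D_i),f(D_j))\le W_p(D_i,D_j)+\epsilon\quad\text{for all }i,j.$$
   Context: Throughout $\mathbb{R}^2$ carries the $\ell^\infty$ distance $d(x,y)=\|x-y\|_\infty$. Wasserstein space: for $1\le p<\infty$, $\mathcal{P}_p(\mathbb{R}^2)$ is the set of Borel probability measures on $\mathbb{R}^2$ with finite $p$-th moment, with the metric $W_p(\alpha,\beta)=\left(\inf_{\gamma}\int d(x,y)^p\,d\gamma(x,y)\right)^{1/p}$, where $\gamma$ ranges over Borel probability measures on $\mathbb{R}^2\times\mathbb{R}^2$ with marginals $\alpha$ and $\beta$. Persistence diagrams: let $\mathbb{R}^2_<=\{(b,d)\in\mathbb{R}^2: b<d\}$ and $\Delta_{\mathbb{R}}=\{(x,x): x\in\mathbb{R}\}$. A persistence diagram is a finite multiset of points of $\mathbb{R}^2_<$ (possibly empty); $\mathcal{D}$ is the set of all of them. A partial matching between $D_1,D_2\in\mathcal{D}$ is a triple $(B_1,B_2,f)$ with $B_1\subseteq D_1$, $B_2\subseteq D_2$ (sub-multisets) and $f\colon B_1\to B_2$ a bijection. Its $p$-cost is $$\mathrm{cost}_p(f)=\Big(\sum_{x\in B_1}d(x,f(x))^p+\sum_{x\in D_1\setminus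 B_1}d(x,\Delta_{\mathbb{R}})^p+\sum_{x\in D_2\setminus B_2}d(x,\Delta_{\mathbb{R}})^p\Big)^{1/p}.$$ The $p$-Wasserstein distance $W_p(D_1,D_2)$ is the infimum of $\mathrm{cost}_p(f)$ over all partial matchings between $D_1$ and $D_2$. The symbol $W_p$ is used for both the distance between measures and the distance between diagrams. *)

theory Defs
  imports "HOL-Probability.Probability" "HOL-Library.Multiset"
begin

definition linf_dist :: "real \<times> real \<Rightarrow> real \<times> real \<Rightarrow> real" where
  "linf_dist x y = infnorm (x - y)"

definition wasserstein_space :: "real \<Rightarrow> (real \<times> real) measure set" where
  "wasserstein_space p =
    {\<alpha>. prob_space \<alpha> \<and> sets \<alpha> = sets borel \<and>
         (\<integral>\<^sup>+ x. ennreal (linf_dist x 0 powr p) \<partial>\<alpha>) < \<infinity>}"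

definition couplings ::
  "(real \<times> real) measure \<Rightarrow> (real \<times> real) measure \<Rightarrow> ((real \<times> real) \<times> (real \<times> real)) measure set" where
  "couplings \<alpha> \<beta> =
    {\<gamma>. prob_space \<gamma> \<and> sets \<gamma> = sets borel \<and> distr \<gamma> borel fst = \<alpha> \<and> distr \<gamma> borel snd = \<beta>}"

(* On wasserstein_space p, for p at least 1, the infimum is finite, so enn2real does not truncate it. *)
definition wasserstein_measure ::
  "real \<Rightarrow> (real \<times> real) measure \<Rightarrow> (real \<times> real) measure \<Rightarrow> real" where
  "wasserstein_measure p \<alpha> \<beta> =
    enn2real (INF \<gamma>\<in>couplings \<alpha> \<beta>. \<integral>\<^sup>+ (x, y). ennreal (linf_dist x y powr p) \<partial>\<gamma>) powr (1 / p)"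

type_synonym diagram = "(real \<times> real) multiset"

definition diagrams :: "diagram set" where
  "diagrams = {D. \<forall>(b, d)\<in>#D. b < d}"

definition diagonal :: "(real \<times> real) set" where
  "diagonal = {(x, x) | x. True}"

definition dist_diagonal :: "real \<times> real \<Rightarrow> real" where
  "dist_diagonal x = (INF y\<in>diagonal. linf_dist x y)"

(* The pair (x, k) stands for the k-th copy of x, so that a bijection between
   multisets is a bijection between their sets of copies. *)
definition copies :: "'a multiset \<Rightarrow> ('a \<times> nat) set" where
  "copies B = {(x, k). k < count B x}"

type_synonym matching =
  "diagram \<times> diagram \<times> ((real \<times> real) \<times> nat \<Rightarrow> (real \<times> real) \<times> nat)"

definition partial_matchings :: "diagram \<Rightarrow> diagram \<Rightarrow> matching set" where
  "partial_matchings D1 D2 =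
    {(B1, B2, f). B1 \<subseteq># D1 \<and> B2 \<subseteq># D2 \<and> bij_betw f (copies B1) (copies B2)}"

definition matching_cost :: "real \<Rightarrow> diagram \<Rightarrow> diagram \<Rightarrow> matching \<Rightarrow> real" where
  "matching_cost p D1 D2 = (\<lambda>(B1, B2, f).
    ((\<Sum>x\<in>copies B1. linf_dist (fst x) (fst (f x)) powr p)
      + (\<Sum>x\<in>#D1 - B1. dist_diagonal x powr p)
      + (\<Sum>x\<in>#D2 - B2. dist_diagonal x powr p)) powr (1 / p))"

definition wasserstein_diagram :: "real \<Rightarrow> diagram \<Rightarrow> diagram \<Rightarrow> real" where
  "wasserstein_diagram p D1 D2 = (INF m\<in>partial_matchings D1 D2. matching_cost p D1 D2 m)"

end

(*
  Replace each diagram A by the uniform probability measure on the multiset consisting of A, some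
  copies of the origin, and m copies of a fine grid on the diagonal, dilated by N^(1/p), where N is
  the common cardinality of these multisets. The dilation cancels the normalisation 1/N, so by
  Birkhoff's theorem the p-th power of the distance of two such measures is the least p-cost of a
  bijection between the two multisets.

  Every bijection restricts to a partial matching that is at most as expensive, because a point
  sent to the diagonal pays at least its distance to it. Conversely, let u and v be left unmatched
  by a partial matching. Send u to a nearby grid point, shift one layer of the grid by one step
  from there up to the grid point near v, and send that one to v. The shift takes O(n) steps of
  length 1/n and costs O(n^(1-p)), which vanishes in the limit because p > 1.
*)

theory Submission
  imports Defs "HOL-Real_Asymp.Real_Asymp"
begin

subsection \<open>Hall's theorem and bistochastic matrices\<close>

text \<open>Induction on \<open>card I\<close>. If some nonempty proper \<open>J\<close> is tight,
  it is matched first and the rest avoids its neighbours. If none is tight, every nonempty proper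
  subset has a neighbour to spare, so one element may be matched with any of its neighbours.\<close>

theorem hall_marriage:
  fixes N :: "'a \<Rightarrow> 'b set"
  assumes "finite I" and "\<And>i. i \<in> I \<Longrightarrow> finite (N i)"
    and "\<And>J. J \<subseteq> I \<Longrightarrow> card J \<le> card (\<Union>(N ` J))"
  shows "\<exists>\<sigma>. inj_on \<sigma> I \<and> (\<forall>i\<in>I. \<sigma> i \<in> N i)"
  using assms
proof (induction "card I" arbitrary: I N rule: less_induct)
  case less
  note fin = less.prems(1) and finN = less.prems(2) and hall = less.prems(3)
  show ?case
  proof (cases "I = {}")
    case True
    then show ?thesis by simp
  next
    case False
    show ?thesis
    proof (cases "\<exists>J. J \<subset> I \<and> J \<noteq> {} \<and> card J = card (\<Union>(N ` J))")
      case True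
      then obtain J where J: "J \<subset> I" "J \<noteq> {}" "card J = card (\<Union>(N ` J))" by blast
      have finJ: "finite J" using J(1) fin by (meson finite_subset psubset_imp_subset)
      have cJ: "card J < card I" using J(1) fin by (rule psubset_card_mono[rotated])
      have cJ': "card (I - J) < card I"
        using J(1,2) fin by (intro psubset_card_mono) auto
      obtain \<sigma> where \<sigma>: "inj_on \<sigma> J" "\<forall>i\<in>J. \<sigma> i \<in> N i"
        using less.hyps[OF cJ finJ, of N] finN hall J(1)
        by (meson order_trans psubsetD psubset_imp_subset)
      let ?N' = "\<lambda>i. N i - \<Union>(N ` J)"
      \<comment> \<open>Hall's condition for \<open>K \<union> J\<close>, minus the equality for the
        tight set \<open>J\<close>, is Hall's condition for the remaining neighbours of
        \<open>K\<close>.\<close>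
      have "card K \<le> card (\<Union>(?N' ` K))" if K: "K \<subseteq> I - J" for K
      proof -
        have finK: "finite K" using K fin by (meson finite_Diff finite_subset)
        have *: "\<Union>(N ` (K \<union> J)) = \<Union>(?N' ` K) \<union> \<Union>(N ` J)" by auto
        have "card K + card J = card (K \<union> J)"
          using K finK finJ by (subst card_Un_disjoint) auto
        also have "\<dots> \<le> card (\<Union>(N ` (K \<union> J)))"
          using hall[of "K \<union> J"] K J(1) by auto
        also have "\<dots> \<le> card (\<Union>(?N' ` K)) + card (\<Union>(N ` J))"
          unfolding * by (rule card_Un_le)
        finally show ?thesis using J(3) by simp
      qed
      then obtain \<tau> where \<tau>: "inj_on \<tau> (I - J)" "\<forall>i\<in>I - J. \<tau> i \<in> ?N' i"
        using less.hyps[OF cJ', of ?N'] fin finN by (meson DiffD1 finite_Diff)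
      let ?\<rho> = "\<lambda>i. if i \<in> J then \<sigma> i else \<tau> i"
      have "\<tau> x \<noteq> \<sigma> y" if "x \<in> I - J" "y \<in> J" for x y
        using that \<sigma>(2) \<tau>(2) by (metis DiffD2 UN_I)
      then have "inj_on ?\<rho> I"
        using \<sigma>(1) \<tau>(1) by (simp add: inj_on_def) metis
      moreover have "\<forall>i\<in>I. ?\<rho> i \<in> N i" using \<sigma>(2) \<tau>(2) by auto
      ultimately show ?thesis by blast
    next
      case nocrit: False
      obtain i where i: "i \<in> I" using False by blast
      have "N i \<noteq> {}" using hall[of "{i}"] i by auto
      then obtain y where y: "y \<in> N i" by blast
      let ?N' = "\<lambda>j. N j - {y}"
      have c: "card (I - {i}) < card I" using i fin by (rule card_Diff1_less[rotated])
      have "card K \<le> card (\<Union>(?N' ` K))" if K: "K \<subseteq> I - {i}" for K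
      proof (cases "K = {}")
        case False
        \<comment> \<open>\<open>K\<close> is proper and not tight, so its inequality is strict and
          survives the loss of the single neighbour \<open>y\<close>.\<close>
        have "K \<subset> I" using K i by auto
        then have "card K < card (\<Union>(N ` K))"
          using nocrit hall[of K] False by (metis le_neq_implies_less psubset_imp_subset)
        moreover have "\<Union>(?N' ` K) = \<Union>(N ` K) - {y}" by auto
        ultimately show ?thesis
          by (auto simp add: card_Diff_singleton_if)
      qed simp
      then obtain \<sigma> where \<sigma>: "inj_on \<sigma> (I - {i})" "\<forall>j\<in>I - {i}. \<sigma> j \<in> ?N' j"
        using less.hyps[OF c, of ?N'] fin finN by (meson DiffD1 finite_Diff)
      have "inj_on (\<sigma>(i := y)) I"
        using \<sigma> by (auto simp: inj_on_def)
      moreover have "\<forall>j\<in>I. (\<sigma>(i := y)) j \<in> N j" using \<sigma>(2) y by auto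
      ultimately show ?thesis by blast
    qed
  qed
qed

text \<open>A consequence of Birkhoff's theorem. Removing from \<open>M\<close> a multiple of a permutation
  matrix supported in \<open>M\<close> shrinks the support; of that permutation and the one found for the
  remainder, the cheaper one will do.\<close>

theorem bij_cost_le_bistochastic:
  fixes M c :: "'a \<Rightarrow> 'b \<Rightarrow> real"
  assumes "finite I" "finite J" "card I = card J"
    and "\<And>i j. i \<in> I \<Longrightarrow> j \<in> J \<Longrightarrow> 0 \<le> M i j"
    and "\<And>i. i \<in> I \<Longrightarrow> (\<Sum>j\<in>J. M i j) = s"
    and "\<And>j. j \<in> J \<Longrightarrow> (\<Sum>i\<in>I. M i j) = s"
    and "0 \<le> s"
  shows "\<exists>\<sigma>. bij_betw \<sigma> I J \<and> s * (\<Sum>i\<in>I. c i (\<sigma> i)) \<le> (\<Sum>i\<in>I. \<Sum>j\<in>J. M i j * c i j)"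
  using assms
proof (induction "card {(i, j). i \<in> I \<and> j \<in> J \<and> M i j \<noteq> 0}" arbitrary: M s rule: less_induct)
  case less
  note fin = less.prems(1,2) and cardIJ = less.prems(3) and nonneg = less.prems(4)
    and row = less.prems(5) and col = less.prems(6)
  show ?case
  proof (cases "s = 0 \<or> I = {}")
    case True
    obtain \<sigma> where "bij_betw \<sigma> I J"
      using fin cardIJ finite_same_card_bij by blast
    moreover have "(\<Sum>i\<in>I. \<Sum>j\<in>J. M i j * c i j) = 0"
    proof (intro sum.neutral ballI)
      fix i j assume ij: "i \<in> I" "j \<in> J"
      then have "(\<Sum>j\<in>J. M i j) = 0" using True row by auto
      then show "M i j * c i j = 0"
        using ij nonneg fin(2) by (simp add: sum_nonneg_eq_0_iff)
    qed
    ultimately show ?thesis using True by auto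
  next
    case False
    then have s: "0 < s" and "I \<noteq> {}" using less.prems(7) by auto
    define N where "N i = {j \<in> J. M i j \<noteq> 0}" for i
    \<comment> \<open>Double counting: the rows in \<open>K\<close> carry mass
      \<open>card K * s\<close>, all of it in the columns \<open>?U\<close>, which hold only
      \<open>card ?U * s\<close>.\<close>
    have "card K \<le> card (\<Union>(N ` K))" if K: "K \<subseteq> I" for K
    proof -
      let ?U = "\<Union>(N ` K)"
      have U: "?U \<subseteq> J" by (auto simp: N_def)
      have "real (card K) * s = (\<Sum>i\<in>K. \<Sum>j\<in>J. M i j)"
        using K row by (simp add: subset_iff)
      also have "\<dots> = (\<Sum>i\<in>K. \<Sum>j\<in>?U. M i j)"
        using fin U by (intro sum.cong refl sum.mono_neutral_right) (auto simp: N_def)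
      also have "\<dots> = (\<Sum>j\<in>?U. \<Sum>i\<in>K. M i j)" by (rule sum.swap)
      also have "\<dots> \<le> (\<Sum>j\<in>?U. \<Sum>i\<in>I. M i j)"
        using K U fin nonneg by (intro sum_mono sum_mono2) auto
      also have "\<dots> = real (card ?U) * s" using U col by (simp add: subset_iff)
      finally show ?thesis using s by simp
    qed
    then obtain \<sigma> where inj: "inj_on \<sigma> I" and \<sigma>N: "\<forall>i\<in>I. \<sigma> i \<in> N i"
      using hall_marriage[of I N] fin by (auto simp: N_def)
    have \<sigma>J: "\<sigma> ` I = J"
      using \<sigma>N fin cardIJ inj by (intro card_subset_eq) (auto simp: N_def card_image)
    then have bij: "bij_betw \<sigma> I J" using inj by (simp add: bij_betw_def)
    \<comment> \<open>The largest multiple of the permutation matrix of \<open>\<sigma>\<close> that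
      can be subtracted while the entries stay nonnegative. The entry at \<open>i0\<close> becomes
      zero, so the support shrinks strictly.\<close>
    define \<delta> where "\<delta> = Min ((\<lambda>i. M i (\<sigma> i)) ` I)"
    have \<delta>le: "\<delta> \<le> M i (\<sigma> i)" if "i \<in> I" for i
      unfolding \<delta>_def using that fin by auto
    obtain i0 where i0: "i0 \<in> I" "M i0 (\<sigma> i0) = \<delta>"
      using Min_in[of "(\<lambda>i. M i (\<sigma> i)) ` I"] \<open>I \<noteq> {}\<close> fin unfolding \<delta>_def by fastforce
    have \<delta>pos: "0 < \<delta>"
      using i0 \<sigma>N nonneg[of i0 "\<sigma> i0"] \<sigma>J by (force simp: N_def)
    define M' where "M' i j = M i j - (if j = \<sigma> i then \<delta> else 0)" for i j
    have delta_sum: "(\<Sum>j\<in>J. (if j = \<sigma> i then \<delta> else 0) * g j) = \<delta> * g (\<sigma> i)" if "i \<in> I" for i g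
    proof -
      have "(\<Sum>j\<in>J. (if j = \<sigma> i then \<delta> else 0) * g j) = (\<Sum>j\<in>J. if j = \<sigma> i then \<delta> * g j else 0)"
        by (intro sum.cong) auto
      then show ?thesis using that \<sigma>J fin by auto
    qed
    have row': "(\<Sum>j\<in>J. M' i j) = s - \<delta>" if "i \<in> I" for i
      using delta_sum[OF that, of "\<lambda>_. 1"] row[OF that] by (simp add: M'_def sum_subtractf)
    have col': "(\<Sum>i\<in>I. M' i j) = s - \<delta>" if j: "j \<in> J" for j
    proof -
      obtain i where i: "i \<in> I" "j = \<sigma> i" using j \<sigma>J by blast
      have "(\<Sum>i'\<in>I. if j = \<sigma> i' then \<delta> else 0) = (\<Sum>i'\<in>I. if i' = i then \<delta> else 0)"
        using i inj by (intro sum.cong) (auto simp: inj_on_def)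
      then show ?thesis using i fin col[OF j] by (simp add: M'_def sum_subtractf)
    qed
    have nonneg': "0 \<le> M' i j" if "i \<in> I" "j \<in> J" for i j
      using that nonneg \<delta>le by (auto simp: M'_def)
    have "\<delta> \<le> s"
    proof -
      have "M i0 (\<sigma> i0) \<le> (\<Sum>j\<in>J. M i0 j)"
        using i0(1) \<sigma>J fin nonneg by (intro member_le_sum) auto
      then show ?thesis using i0 row by simp
    qed
    have "{(i, j). i \<in> I \<and> j \<in> J \<and> M' i j \<noteq> 0} \<subset> {(i, j). i \<in> I \<and> j \<in> J \<and> M i j \<noteq> 0}"
    proof (rule psubsetI)
      show "{(i, j). i \<in> I \<and> j \<in> J \<and> M' i j \<noteq> 0} \<subseteq> {(i, j). i \<in> I \<and> j \<in> J \<and> M i j \<noteq> 0}"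
        using \<sigma>N by (auto simp: M'_def N_def)
      have "(i0, \<sigma> i0) \<in> {(i, j). i \<in> I \<and> j \<in> J \<and> M i j \<noteq> 0}"
        "(i0, \<sigma> i0) \<notin> {(i, j). i \<in> I \<and> j \<in> J \<and> M' i j \<noteq> 0}"
        using i0 \<sigma>N by (auto simp: M'_def N_def)
      then show "{(i, j). i \<in> I \<and> j \<in> J \<and> M' i j \<noteq> 0} \<noteq> {(i, j). i \<in> I \<and> j \<in> J \<and> M i j \<noteq> 0}"
        by blast
    qed
    moreover have "finite {(i, j). i \<in> I \<and> j \<in> J \<and> M i j \<noteq> 0}"
      by (rule finite_subset[of _ "I \<times> J"]) (use fin in auto)
    ultimately have "card {(i, j). i \<in> I \<and> j \<in> J \<and> M' i j \<noteq> 0}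
        < card {(i, j). i \<in> I \<and> j \<in> J \<and> M i j \<noteq> 0}"
      by (intro psubset_card_mono)
    from less.hyps[OF this fin cardIJ nonneg' row' col'] \<open>\<delta> \<le> s\<close>
    obtain \<tau> where \<tau>: "bij_betw \<tau> I J"
      "(s - \<delta>) * (\<Sum>i\<in>I. c i (\<tau> i)) \<le> (\<Sum>i\<in>I. \<Sum>j\<in>J. M' i j * c i j)"
      by auto
    let ?C = "\<lambda>\<rho>. \<Sum>i\<in>I. c i (\<rho> i)"
    have "(\<Sum>i\<in>I. \<Sum>j\<in>J. M' i j * c i j)
        = (\<Sum>i\<in>I. \<Sum>j\<in>J. M i j * c i j) - \<delta> * ?C \<sigma>"
      using delta_sum by (simp add: M'_def left_diff_distrib sum_subtractf sum_distrib_left)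
    \<comment> \<open>The left side is a combination of the two costs with nonnegative weights of
      sum \<open>s\<close>, hence at least \<open>s\<close> times the smaller one.\<close>
    with \<tau>(2) have tot: "(s - \<delta>) * ?C \<tau> + \<delta> * ?C \<sigma> \<le> (\<Sum>i\<in>I. \<Sum>j\<in>J. M i j * c i j)"
      by simp
    show ?thesis
    proof (cases "?C \<tau> \<le> ?C \<sigma>")
      case True
      then have "\<delta> * ?C \<tau> \<le> \<delta> * ?C \<sigma>" using \<delta>pos by (intro mult_left_mono) auto
      then have "s * ?C \<tau> \<le> (\<Sum>i\<in>I. \<Sum>j\<in>J. M i j * c i j)"
        using tot by (simp add: left_diff_distrib)
      then show ?thesis using \<tau>(1) by blast
    next
      case False
      then have "(s - \<delta>) * ?C \<sigma> \<le> (s - \<delta>) * ?C \<tau>"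
        using \<open>\<delta> \<le> s\<close> by (intro mult_left_mono) auto
      then have "s * ?C \<sigma> \<le> (\<Sum>i\<in>I. \<Sum>j\<in>J. M i j * c i j)"
        using tot by (simp add: left_diff_distrib)
      then show ?thesis using bij by blast
    qed
  qed
qed

subsection \<open>The geometry of the plane with the maximum distance\<close>

lemma linf_dist_Pair: "linf_dist (a, b) (c, d) = max \<bar>a - c\<bar> \<bar>b - d\<bar>"
  by (simp add: linf_dist_def infnorm_Max Basis_prod_def insert_commute max.commute)

lemma linf_dist_nonneg: "0 \<le> linf_dist x y"
  by (simp add: linf_dist_def infnorm_pos_le)

lemma linf_dist_commute: "linf_dist x y = linf_dist y x"
  by (simp add: linf_dist_def infnorm_sub)

lemma linf_dist_self: "linf_dist x x = 0"
  by (simp add: linf_dist_def infnorm_0)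

lemma linf_dist_triangle: "linf_dist x z \<le> linf_dist x y + linf_dist y z"
  using infnorm_triangle[of "x - y" "y - z"] by (simp add: linf_dist_def)

lemma linf_dist_scaleR: "linf_dist (a *\<^sub>R x) (a *\<^sub>R y) = \<bar>a\<bar> * linf_dist x y"
  by (simp add: linf_dist_def infnorm_mul flip: scaleR_diff_right)

lemma diagonal_iff: "x \<in> diagonal \<longleftrightarrow> fst x = snd x"
  by (cases x) (auto simp: diagonal_def)

lemma dist_diagonal_le: "y \<in> diagonal \<Longrightarrow> dist_diagonal x \<le> linf_dist x y"
  unfolding dist_diagonal_def
  by (rule cINF_lower) (auto intro: bdd_belowI[of _ 0] simp: linf_dist_nonneg)

lemma dist_diagonal_le': "y \<in> diagonal \<Longrightarrow> dist_diagonal x \<le> linf_dist y x"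
  using dist_diagonal_le linf_dist_commute by metis

text \<open>The midpoint of the two coordinates is a nearest parameter: both coordinates are then
  off by half their difference, and no other choice makes the larger deviation smaller.\<close>

lemma dist_diagonal_attained: "\<exists>t. linf_dist x (t, t) = dist_diagonal x"
proof (cases x)
  case (Pair b d)
  define t where "t = (b + d) / 2"
  have "linf_dist x (t, t) \<le> dist_diagonal x"
    unfolding dist_diagonal_def
  proof (rule cINF_greatest)
    show "diagonal \<noteq> {}" by (auto simp: diagonal_def)
    fix y assume "y \<in> diagonal"
    then obtain s where "y = (s, s)" by (auto simp: diagonal_def)
    then show "linf_dist x (t, t) \<le> linf_dist x y"
      by (simp add: Pair linf_dist_Pair t_def field_simps) (simp add: max_def abs_if split: if_splits)
  qed
  moreover have "dist_diagonal x \<le> linf_dist x (t, t)"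
    by (rule dist_diagonal_le) (simp add: diagonal_def)
  ultimately show ?thesis by (intro exI[of _ t]) simp
qed

lemma dist_diagonal_nonneg: "0 \<le> dist_diagonal x"
  using dist_diagonal_attained[of x] linf_dist_nonneg by metis

lemma dist_diagonal_eq_0: "x \<in> diagonal \<Longrightarrow> dist_diagonal x = 0"
  using dist_diagonal_le[of x x] dist_diagonal_nonneg[of x] by (simp add: linf_dist_self)

subsection \<open>Transport plans between multisets\<close>

text \<open>A bijection with multiplicities, encoded as a multiset of pairs. In this form plans can
  be added, reversed and filtered without handling the indices of copies.\<close>

definition plans :: "'a multiset \<Rightarrow> 'b multiset \<Rightarrow> ('a \<times> 'b) multiset set" where
  "plans A B = {\<Gamma>. image_mset fst \<Gamma> = A \<and> image_mset snd \<Gamma> = B}"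

definition plan_cost :: "real \<Rightarrow> ((real \<times> real) \<times> (real \<times> real)) multiset \<Rightarrow> real" where
  "plan_cost p \<Gamma> = (\<Sum>(x, y)\<in>#\<Gamma>. linf_dist x y powr p)"

lemma plan_cost_simps [simp]:
  "plan_cost p {#} = 0"
  "plan_cost p (add_mset z \<Gamma>) = linf_dist (fst z) (snd z) powr p + plan_cost p \<Gamma>"
  "plan_cost p (\<Gamma> + \<Gamma>') = plan_cost p \<Gamma> + plan_cost p \<Gamma>'"
  by (simp_all add: plan_cost_def case_prod_unfold)

lemma sum_mset_powr_nonneg: "0 \<le> (\<Sum>x\<in>#A. g x powr p :: real)"
  by (induction A) auto

lemma plan_cost_nonneg: "0 \<le> plan_cost p \<Gamma>"
  by (induction \<Gamma>) auto

lemma plans_add: "\<Gamma> \<in> plans A B \<Longrightarrow> \<Gamma>' \<in> plans A' B' \<Longrightarrow> \<Gamma> + \<Gamma>' \<in> plans (A + A') (B + B')"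
  by (auto simp: plans_def)

lemma plans_refl: "\<exists>\<Gamma>\<in>plans A A. plan_cost p \<Gamma> = 0"
proof (induction A)
  case (add x A)
  then obtain \<Gamma> where "\<Gamma> \<in> plans A A" "plan_cost p \<Gamma> = 0" by blast
  then show ?case
    by (intro bexI[of _ "add_mset (x, x) \<Gamma>"]) (auto simp: plans_def linf_dist_self)
qed (auto simp: plans_def)

lemma plans_sym:
  assumes "\<Gamma> \<in> plans A B"
  shows "\<exists>\<Gamma>'\<in>plans B A. plan_cost p \<Gamma>' = plan_cost p \<Gamma>"
proof (intro bexI)
  show "image_mset prod.swap \<Gamma> \<in> plans B A"
    using assms by (simp add: plans_def multiset.map_comp comp_def)
  show "plan_cost p (image_mset prod.swap \<Gamma>) = plan_cost p \<Gamma>"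
    by (simp add: plan_cost_def multiset.map_comp comp_def case_prod_unfold linf_dist_commute)
qed

section \<open>Plans and bijections between sets of copies\<close>

lemma copies_empty [simp]: "copies {#} = {}"
  by (simp add: copies_def)

lemma copies_add_mset: "copies (add_mset x A) = insert (x, count A x) (copies A)"
  by (auto simp: copies_def split: if_splits)

lemma notin_copies: "(x, count A x) \<notin> copies A"
  by (simp add: copies_def)

lemma finite_copies [simp]: "finite (copies A)"
  by (induction A) (simp_all add: copies_add_mset)

lemma card_copies: "card (copies A) = size A"
  by (induction A) (simp_all add: copies_add_mset notin_copies)

lemma image_fst_mset_set_copies: "image_mset fst (mset_set (copies A)) = A"
  by (induction A) (simp_all add: copies_add_mset notin_copies)

lemma sum_copies: "(\<Sum>x\<in>copies A. g (fst x)) = (\<Sum>x\<in>#A. g x)"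
  by (induction A) (simp_all add: copies_add_mset notin_copies)

text \<open>Induction on the plan: each new pair joins the next free copy of its first point to the
  next free copy of its second.\<close>

lemma bij_copies_of_plan:
  fixes g :: "'a \<Rightarrow> 'b \<Rightarrow> real"
  assumes "\<Gamma> \<in> plans A B"
  shows "\<exists>f. bij_betw f (copies A) (copies B) \<and>
    (\<Sum>x\<in>copies A. g (fst x) (fst (f x))) = (\<Sum>(x, y)\<in>#\<Gamma>. g x y)"
  using assms
proof (induction \<Gamma> arbitrary: A B)
  case empty
  then show ?case by (auto simp: plans_def bij_betw_def)
next
  case (add z \<Gamma>)
  obtain x y where z: "z = (x, y)" by (cases z)
  let ?A = "image_mset fst \<Gamma>" and ?B = "image_mset snd \<Gamma>"
  have AB: "A = add_mset x ?A" "B = add_mset y ?B" using add.prems z by (auto simp: plans_def)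
  obtain f where f: "bij_betw f (copies ?A) (copies ?B)"
    "(\<Sum>x\<in>copies ?A. g (fst x) (fst (f x))) = (\<Sum>(x, y)\<in>#\<Gamma>. g x y)"
    using add.IH[of ?A ?B] by (auto simp: plans_def)
  \<comment> \<open>Copies are numbered from \<open>0\<close>, so \<open>count ?A x\<close> is the
    index of the first copy of \<open>x\<close> not yet in use.\<close>
  let ?f = "f((x, count ?A x) := (y, count ?B y))"
  have eq: "?f u = f u" if "u \<in> copies ?A" for u
    using that by (auto simp: notin_copies)
  have "bij_betw ?f (copies ?A) (copies ?B)"
    using f(1) eq by (subst bij_betw_cong[of _ _ f]) auto
  then have "bij_betw ?f (copies ?A \<union> {(x, count ?A x)}) (copies ?B \<union> {(y, count ?B y)})"
    by (intro bij_betw_combine) (auto simp: notin_copies bij_betw_def)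
  then have "bij_betw ?f (copies A) (copies B)" by (simp add: AB copies_add_mset)
  moreover have "(\<Sum>u\<in>copies A. g (fst u) (fst (?f u))) = (\<Sum>(x, y)\<in>#add_mset z \<Gamma>. g x y)"
  proof -
    have "(\<Sum>u\<in>copies A. g (fst u) (fst (?f u))) = g x y + (\<Sum>u\<in>copies ?A. g (fst u) (fst (?f u)))"
      unfolding AB copies_add_mset by (subst sum.insert) (auto simp: notin_copies)
    also have "(\<Sum>u\<in>copies ?A. g (fst u) (fst (?f u))) = (\<Sum>u\<in>copies ?A. g (fst u) (fst (f u)))"
      using eq by (intro sum.cong) auto
    finally show ?thesis using f(2) z by simp
  qed
  ultimately show ?case by blast
qed

text \<open>The converse passage: forgetting the indices of the copies turns a bijection into a plan
  of the same cost.\<close>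

lemma plan_of_bij_copies:
  fixes g :: "'a \<Rightarrow> 'b \<Rightarrow> real"
  assumes "bij_betw f (copies A) (copies B)"
  shows "\<exists>\<Gamma>\<in>plans A B. (\<Sum>(x, y)\<in>#\<Gamma>. g x y) = (\<Sum>x\<in>copies A. g (fst x) (fst (f x)))"
proof
  let ?\<Gamma> = "image_mset (\<lambda>x. (fst x, fst (f x))) (mset_set (copies A))"
  have "image_mset f (mset_set (copies A)) = mset_set (copies B)"
    using assms by (simp add: bij_betw_def image_mset_mset_set)
  from arg_cong[OF this, of "image_mset fst"]
  have "image_mset (\<lambda>x. fst (f x)) (mset_set (copies A)) = B"
    by (simp add: multiset.map_comp comp_def image_fst_mset_set_copies)
  then show "?\<Gamma> \<in> plans A B"
    by (simp add: plans_def multiset.map_comp comp_def image_fst_mset_set_copies)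
  show "(\<Sum>(x, y)\<in>#?\<Gamma>. g x y) = (\<Sum>x\<in>copies A. g (fst x) (fst (f x)))"
    by (simp add: multiset.map_comp comp_def sum_unfold_sum_mset)
qed

lemma plans_nonempty: "size A = size B \<Longrightarrow> plans A B \<noteq> {}"
  using finite_same_card_bij[of "copies A" "copies B"] plan_of_bij_copies[of _ A B "\<lambda>_ _. 0"]
  by (auto simp: card_copies)

section \<open>The distance of diagrams, and plans between padded diagrams\<close>

lemma wasserstein_diagram_le:
  assumes "m \<in> partial_matchings A B"
  shows "wasserstein_diagram p A B \<le> matching_cost p A B m"
  unfolding wasserstein_diagram_def using assms
  by (intro cINF_lower bdd_belowI[of _ 0]) (auto simp: matching_cost_def)

lemma partial_matchings_nonempty: "partial_matchings A B \<noteq> {}"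
proof -
  have "({#}, {#}, id) \<in> partial_matchings A B" by (simp add: partial_matchings_def)
  then show ?thesis by blast
qed

lemma wasserstein_diagram_nonneg: "0 \<le> wasserstein_diagram p A B"
  unfolding wasserstein_diagram_def using partial_matchings_nonempty
  by (intro cINF_greatest) (auto simp: matching_cost_def)

text \<open>Discarding the diagonal points of a plan leaves a partial matching: a point moved to the
  diagonal pays at least its distance to it.\<close>

lemma wasserstein_diagram_le_plan_cost:
  assumes p: "0 < p" and AB: "A \<in> diagrams" "B \<in> diagrams"
    and XY: "set_mset X \<subseteq> diagonal" "set_mset Y \<subseteq> diagonal"
    and \<Gamma>: "\<Gamma> \<in> plans (A + X) (B + Y)"
  shows "wasserstein_diagram p A B powr p \<le> plan_cost p \<Gamma>"
proof -
  let ?P = "\<lambda>z :: (real \<times> real) \<times> (real \<times> real). fst z \<notin> diagonal"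
  let ?Q = "\<lambda>z :: (real \<times> real) \<times> (real \<times> real). snd z \<notin> diagonal"
  \<comment> \<open>Pairs are sorted by which of their ends lie off the diagonal:
    \<open>\<Gamma>0\<close> becomes the matching, \<open>\<Gamma>1\<close> and
    \<open>\<Gamma>2\<close> contain the unmatched points of \<open>A\<close> and \<open>B\<close>,
    and \<open>\<Gamma>3\<close> is dropped.\<close>
  define \<Gamma>0 where "\<Gamma>0 = {#z \<in># \<Gamma>. ?P z \<and> ?Q z#}"
  define \<Gamma>1 where "\<Gamma>1 = {#z \<in># \<Gamma>. ?P z \<and> \<not> ?Q z#}"
  define \<Gamma>2 where "\<Gamma>2 = {#z \<in># \<Gamma>. \<not> ?P z \<and> ?Q z#}"
  define \<Gamma>3 where "\<Gamma>3 = {#z \<in># \<Gamma>. \<not> ?P z \<and> \<not> ?Q z#}"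
  have split: "\<Gamma> = \<Gamma>0 + \<Gamma>1 + \<Gamma>2 + \<Gamma>3"
    by (rule multiset_eqI) (simp add: \<Gamma>0_def \<Gamma>1_def \<Gamma>2_def \<Gamma>3_def)
  \<comment> \<open>Points of a diagram satisfy \<open>b < d\<close>, so removing the diagonal
    points removes exactly \<open>X\<close>.\<close>
  have filt: "filter_mset (\<lambda>x. x \<notin> diagonal) (A + X) = A" if "A \<in> diagrams" "set_mset X \<subseteq> diagonal" for A X
  proof -
    have "filter_mset (\<lambda>x. x \<notin> diagonal) A = A"
      using that(1) by (subst filter_mset_eq_conv) (auto simp: diagrams_def diagonal_def)
    moreover have "filter_mset (\<lambda>x. x \<notin> diagonal) X = {#}"
      using that(2) by (intro multiset_eqI) (auto simp: count_eq_zero_iff)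
    ultimately show ?thesis by simp
  qed
  have "A = filter_mset (\<lambda>x. x \<notin> diagonal) (image_mset fst \<Gamma>)"
    using filt[OF AB(1) XY(1)] \<Gamma> by (simp add: plans_def)
  also have "\<dots> = image_mset fst (filter_mset ?P \<Gamma>)" by (simp add: filter_mset_image_mset)
  also have "filter_mset ?P \<Gamma> = \<Gamma>0 + \<Gamma>1"
    by (rule multiset_eqI) (simp add: \<Gamma>0_def \<Gamma>1_def)
  finally have A: "A = image_mset fst \<Gamma>0 + image_mset fst \<Gamma>1" by simp
  have "B = filter_mset (\<lambda>x. x \<notin> diagonal) (image_mset snd \<Gamma>)"
    using filt[OF AB(2) XY(2)] \<Gamma> by (simp add: plans_def)
  also have "\<dots> = image_mset snd (filter_mset ?Q \<Gamma>)" by (simp add: filter_mset_image_mset)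
  also have "filter_mset ?Q \<Gamma> = \<Gamma>0 + \<Gamma>2"
    by (rule multiset_eqI) (simp add: \<Gamma>0_def \<Gamma>2_def)
  finally have B: "B = image_mset snd \<Gamma>0 + image_mset snd \<Gamma>2" by simp
  obtain f where f: "bij_betw f (copies (image_mset fst \<Gamma>0)) (copies (image_mset snd \<Gamma>0))"
    "(\<Sum>x\<in>copies (image_mset fst \<Gamma>0). linf_dist (fst x) (fst (f x)) powr p) = plan_cost p \<Gamma>0"
    using bij_copies_of_plan[of \<Gamma>0 "image_mset fst \<Gamma>0" "image_mset snd \<Gamma>0" "\<lambda>x y. linf_dist x y powr p"]
    by (auto simp: plans_def plan_cost_def)
  let ?m = "(image_mset fst \<Gamma>0, image_mset snd \<Gamma>0, f)"
  let ?S = "plan_cost p \<Gamma>0 + (\<Sum>z\<in>#\<Gamma>1. dist_diagonal (fst z) powr p) + (\<Sum>z\<in>#\<Gamma>2. dist_diagonal (snd z) powr p)"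
  have "?m \<in> partial_matchings A B"
    using f(1) A B by (simp add: partial_matchings_def)
  then have "wasserstein_diagram p A B \<le> matching_cost p A B ?m"
    by (rule wasserstein_diagram_le)
  also have "matching_cost p A B ?m = ?S powr (1 / p)"
    using f(2) by (simp add: matching_cost_def A B multiset.map_comp comp_def)
  finally have "wasserstein_diagram p A B powr p \<le> (?S powr (1 / p)) powr p"
    using p by (intro powr_mono2 wasserstein_diagram_nonneg) auto
  also have "\<dots> = ?S"
    using p by (simp add: powr_powr plan_cost_nonneg sum_mset_powr_nonneg)
  also have "(\<Sum>z\<in>#\<Gamma>1. dist_diagonal (fst z) powr p) \<le> plan_cost p \<Gamma>1"
    unfolding plan_cost_def case_prod_unfold using p
    by (intro sum_mset_mono powr_mono2 dist_diagonal_le) (auto simp: \<Gamma>1_def dist_diagonal_nonneg)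
  also have "(\<Sum>z\<in>#\<Gamma>2. dist_diagonal (snd z) powr p) \<le> plan_cost p \<Gamma>2"
    unfolding plan_cost_def case_prod_unfold using p
    by (intro sum_mset_mono powr_mono2 dist_diagonal_le') (auto simp: \<Gamma>2_def dist_diagonal_nonneg)
  also have "plan_cost p \<Gamma>0 + plan_cost p \<Gamma>1 + plan_cost p \<Gamma>2 \<le> plan_cost p \<Gamma>"
    unfolding split by (simp add: plan_cost_nonneg)
  finally show ?thesis by simp
qed

subsection \<open>Moving mass along the diagonal\<close>

definition grid_point :: "nat \<Rightarrow> int \<Rightarrow> real \<times> real" where
  "grid_point n i = (of_int i / real n, of_int i / real n)"

text \<open>For positive \<open>n\<close> the spacing is \<open>1 / n\<close> and the grid reaches
  from \<open>(-n, -n)\<close> to \<open>(n, n)\<close>, so that a single parameter both refines and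
  extends it.\<close>

definition grid :: "nat \<Rightarrow> (real \<times> real) multiset" where
  "grid n = image_mset (grid_point n) (mset_set {- int (n\<^sup>2)..int (n\<^sup>2)})"

lemma set_grid_subset_diagonal: "set_mset (grid n) \<subseteq> diagonal"
  by (auto simp: grid_def grid_point_def diagonal_def)

text \<open>One unit of mass at \<open>u\<close> enters the grid at \<open>g k\<close>, every grid point between \<open>k\<close> and
  \<open>l\<close> advances by one step, and the mass at \<open>g l\<close> leaves for \<open>v\<close>.\<close>

lemma path_plan:
  fixes g :: "int \<Rightarrow> real \<times> real"
  assumes kl: "a \<le> k" "k \<le> l" "l \<le> b"
    and step: "\<And>i. linf_dist (g i) (g (i + 1)) = h"
  shows "\<exists>\<Gamma>\<in>plans (add_mset u (image_mset g (mset_set {a..b}))) (add_mset v (image_mset g (mset_set {a..b}))).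
    plan_cost p \<Gamma> = linf_dist u (g k) powr p + linf_dist (g l) v powr p + real_of_int (l - k) * h powr p"
proof
  let ?R = "mset_set ({a..<k} \<union> {l<..b})"
  let ?\<Gamma> = "add_mset (u, g k) (add_mset (g l, v)
    (image_mset (\<lambda>i. (g i, g (i + 1))) (mset_set {k..<l}) + image_mset (\<lambda>i. (g i, g i)) ?R))"
  \<comment> \<open>The interval is decomposed twice: by sources, where \<open>l\<close> is the
    index that leaves for \<open>v\<close>, and by targets, where \<open>k\<close> is the index
    reached from \<open>u\<close>.\<close>
  have "{a..b} = insert l ({k..<l} \<union> ({a..<k} \<union> {l<..b}))" using kl by auto
  moreover have "mset_set ({k..<l} \<union> ({a..<k} \<union> {l<..b})) = mset_set {k..<l} + ?R"
    by (rule mset_set_Union) auto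
  ultimately have 1: "mset_set {a..b} = add_mset l (mset_set {k..<l} + ?R)"
    using kl by simp
  have "{a..b} = insert k ((\<lambda>i. i + 1) ` {k..<l} \<union> ({a..<k} \<union> {l<..b}))"
    using kl by (auto simp: image_iff)
  moreover have "mset_set ((\<lambda>i. i + 1) ` {k..<l} \<union> ({a..<k} \<union> {l<..b}))
      = mset_set ((\<lambda>i. i + 1) ` {k..<l}) + ?R"
    by (rule mset_set_Union) auto
  ultimately have "mset_set {a..b} = add_mset k (mset_set ((\<lambda>i. i + 1) ` {k..<l}) + ?R)"
    using kl by (simp add: image_iff)
  also have "mset_set ((\<lambda>i. i + 1) ` {k..<l}) = image_mset (\<lambda>i. i + 1) (mset_set {k..<l})"
    by (rule image_mset_mset_set[symmetric]) simp
  finally have 2: "mset_set {a..b} = add_mset k (image_mset (\<lambda>i. i + 1) (mset_set {k..<l}) + ?R)" .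
  have "image_mset fst ?\<Gamma> = add_mset u (image_mset g (mset_set {a..b}))"
    unfolding 1 by (simp add: multiset.map_comp comp_def)
  moreover have "image_mset snd ?\<Gamma> = add_mset v (image_mset g (mset_set {a..b}))"
    unfolding 2 by (simp add: multiset.map_comp comp_def)
  ultimately show "?\<Gamma> \<in> plans (add_mset u (image_mset g (mset_set {a..b}))) (add_mset v (image_mset g (mset_set {a..b})))"
    by (simp add: plans_def)
  have "plan_cost p (image_mset (\<lambda>i. (g i, g (i + 1))) (mset_set {k..<l})) = real_of_int (l - k) * h powr p"
    using kl by (simp add: plan_cost_def multiset.map_comp comp_def step)
  moreover have "plan_cost p (image_mset (\<lambda>i. (g i, g i)) ?R) = 0"
    by (simp add: plan_cost_def multiset.map_comp comp_def linf_dist_self)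
  ultimately show "plan_cost p ?\<Gamma>
      = linf_dist u (g k) powr p + linf_dist (g l) v powr p + real_of_int (l - k) * h powr p"
    by simp
qed

text \<open>The path enters and leaves at the grid points obtained by rounding down the parameters
  \<open>s\<close> and \<open>t\<close>. The rounding adds at most \<open>1 / n\<close> to either
  end and at most one step to the path.\<close>

lemma grid_plan_ordered:
  assumes p: "0 < p" and n: "1 \<le> n"
    and u: "linf_dist u (s, s) = dist_diagonal u" and v: "linf_dist v (t, t) = dist_diagonal v"
    and st: "s \<le> t" "\<bar>s\<bar> \<le> real n - 1" "\<bar>t\<bar> \<le> real n - 1"
  shows "\<exists>\<Gamma>\<in>plans (add_mset u (grid n)) (add_mset v (grid n)).
    plan_cost p \<Gamma> \<le> (dist_diagonal u + 1 / n) powr p + (dist_diagonal v + 1 / n) powr p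
      + (\<bar>t - s\<bar> * n + 1) * (1 / n) powr p"
proof -
  define k where "k = \<lfloor>s * n\<rfloor>"
  define l where "l = \<lfloor>t * n\<rfloor>"
  have n0: "0 < real n" using n by simp
  have near: "linf_dist w (grid_point n \<lfloor>r * n\<rfloor>) \<le> dist_diagonal w + 1 / n"
    if "linf_dist w (r, r) = dist_diagonal w" for w and r :: real
  proof -
    have "linf_dist (r, r) (grid_point n \<lfloor>r * n\<rfloor>) = \<bar>r * n - of_int \<lfloor>r * n\<rfloor>\<bar> / n"
      using n0 by (simp add: grid_point_def linf_dist_Pair abs_divide[symmetric] field_simps)
    also have "\<dots> \<le> 1 / n"
      using n0 by (intro divide_right_mono) linarith+
    finally show ?thesis
      using linf_dist_triangle[of w "grid_point n \<lfloor>r * n\<rfloor>" "(r, r)"] that by simp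
  qed
  \<comment> \<open>The margin between \<open>real n - 1\<close> and \<open>n\<close> absorbs the
    rounding, so the index stays within the grid.\<close>
  have bound: "\<bar>\<lfloor>r * n\<rfloor>\<bar> \<le> int (n\<^sup>2)" if "\<bar>r\<bar> \<le> real n - 1" for r :: real
  proof -
    have "\<bar>r * n\<bar> \<le> (real n - 1) * n"
      using that by (simp add: abs_mult mult_right_mono)
    also have "\<dots> \<le> real (n\<^sup>2) - 1"
      using n by (simp add: algebra_simps power2_eq_square)
    finally show ?thesis by linarith
  qed
  have "k \<le> l" unfolding k_def l_def using st(1) n0 by (intro floor_mono mult_right_mono) auto
  have step: "linf_dist (grid_point n i) (grid_point n (i + 1)) = 1 / n" for i
    using n0 by (simp add: grid_point_def linf_dist_Pair flip: diff_divide_distrib)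
  obtain \<Gamma> where \<Gamma>: "\<Gamma> \<in> plans (add_mset u (grid n)) (add_mset v (grid n))"
    "plan_cost p \<Gamma> = linf_dist u (grid_point n k) powr p + linf_dist (grid_point n l) v powr p
      + real_of_int (l - k) * (1 / n) powr p"
    using path_plan[of "- int (n\<^sup>2)" k l "int (n\<^sup>2)" "grid_point n" "1 / n" u v p]
      \<open>k \<le> l\<close> bound[OF st(2)] bound[OF st(3)] step
    unfolding grid_def k_def l_def by (auto simp: abs_le_iff)
  have "linf_dist u (grid_point n k) powr p \<le> (dist_diagonal u + 1 / n) powr p"
    unfolding k_def using p by (intro powr_mono2 near u linf_dist_nonneg) auto
  moreover have "linf_dist (grid_point n l) v powr p \<le> (dist_diagonal v + 1 / n) powr p"
    unfolding l_def using p near[OF v]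
    by (intro powr_mono2 linf_dist_nonneg) (auto simp: linf_dist_commute)
  moreover have "real_of_int (l - k) * (1 / n) powr p \<le> (\<bar>t - s\<bar> * n + 1) * (1 / n) powr p"
  proof (rule mult_right_mono)
    have "real_of_int (l - k) \<le> t * n - s * n + 1" unfolding k_def l_def by linarith
    then show "real_of_int (l - k) \<le> \<bar>t - s\<bar> * n + 1" using st(1) by (simp add: algebra_simps)
  qed simp
  ultimately show ?thesis using \<Gamma> by (intro bexI[of _ \<Gamma>]) auto
qed

text \<open>If \<open>t < s\<close>, the path from \<open>v\<close> to \<open>u\<close> is run
  backwards; the bound is symmetric in the two ends.\<close>

lemma grid_plan:
  assumes p: "0 < p" and n: "1 \<le> n"
    and u: "linf_dist u (s, s) = dist_diagonal u" and v: "linf_dist v (t, t) = dist_diagonal v"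
    and st: "\<bar>s\<bar> \<le> real n - 1" "\<bar>t\<bar> \<le> real n - 1"
  shows "\<exists>\<Gamma>\<in>plans (add_mset u (grid n)) (add_mset v (grid n)).
    plan_cost p \<Gamma> \<le> (dist_diagonal u + 1 / n) powr p + (dist_diagonal v + 1 / n) powr p
      + (\<bar>t - s\<bar> * n + 1) * (1 / n) powr p"
proof (cases "s \<le> t")
  case True
  then show ?thesis using grid_plan_ordered assms by blast
next
  case False
  then obtain \<Gamma> where \<Gamma>: "\<Gamma> \<in> plans (add_mset v (grid n)) (add_mset u (grid n))"
    "plan_cost p \<Gamma> \<le> (dist_diagonal v + 1 / n) powr p + (dist_diagonal u + 1 / n) powr p
      + (\<bar>s - t\<bar> * n + 1) * (1 / n) powr p"
    using grid_plan_ordered[OF p n v u] st by fastforce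
  with plans_sym[OF \<Gamma>(1), of p] show ?thesis
    by (metis add.commute abs_minus_commute)
qed

text \<open>The assumption \<open>1 < p\<close> is essential here: the path costs at most
  \<open>\<bar>t - s\<bar> * n powr (1 - p) + n powr (- p)\<close>, which vanishes in the limit,
  whereas for \<open>p = 1\<close> the term \<open>\<bar>t - s\<bar>\<close> would survive.\<close>

lemma grid_plan_eventually:
  assumes p: "1 < p" and \<eta>: "0 < \<eta>"
  shows "\<forall>\<^sub>F n in sequentially. \<exists>\<Gamma>\<in>plans (add_mset u (grid n)) (add_mset v (grid n)).
    plan_cost p \<Gamma> \<le> dist_diagonal u powr p + dist_diagonal v powr p + \<eta>"
proof -
  obtain s where s: "linf_dist u (s, s) = dist_diagonal u" using dist_diagonal_attained by blast
  obtain t where t: "linf_dist v (t, t) = dist_diagonal v" using dist_diagonal_attained by blast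
  let ?e = "\<lambda>n. (dist_diagonal u + 1 / real n) powr p + (dist_diagonal v + 1 / real n) powr p
      + (\<bar>t - s\<bar> * real n + 1) * (1 / real n) powr p"
  have inv: "(\<lambda>n. 1 / real n) \<longlonglongrightarrow> 0" by real_asymp
  have pow: "(\<lambda>n. (a + 1 / real n) powr p) \<longlonglongrightarrow> a powr p" if "0 \<le> a" for a
    using tendsto_powr2[OF tendsto_add[OF tendsto_const inv] tendsto_const, of a p] that p by simp
  have "(\<lambda>n. \<bar>t - s\<bar> * real n powr (1 - p) + real n powr (- p)) \<longlonglongrightarrow> \<bar>t - s\<bar> * 0 + 0"
    using p by (intro tendsto_intros tendsto_neg_powr filterlim_real_sequentially) auto
  moreover have "\<forall>\<^sub>F n in sequentially. \<bar>t - s\<bar> * real n powr (1 - p) + real n powr (- p)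
      = (\<bar>t - s\<bar> * real n + 1) * (1 / real n) powr p"
    using eventually_gt_at_top[of 0]
    by eventually_elim (simp add: powr_diff powr_minus powr_divide field_simps)
  ultimately have "(\<lambda>n. (\<bar>t - s\<bar> * real n + 1) * (1 / real n) powr p) \<longlonglongrightarrow> 0"
    by (simp add: tendsto_cong)
  from tendsto_add[OF tendsto_add[OF pow pow] this]
  have "?e \<longlonglongrightarrow> dist_diagonal u powr p + dist_diagonal v powr p"
    by (simp add: dist_diagonal_nonneg)
  then have "\<forall>\<^sub>F n in sequentially. ?e n < dist_diagonal u powr p + dist_diagonal v powr p + \<eta>"
    by (rule order_tendstoD) (use \<eta> in simp)
  \<comment> \<open>From some \<open>n\<close> on, the grid reaches beyond both parameters.\<close>
  moreover have "\<forall>\<^sub>F n in sequentially. max \<bar>s\<bar> \<bar>t\<bar> + 1 \<le> real n"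
    using filterlim_real_sequentially by (auto simp: filterlim_at_top)
  ultimately show ?thesis
  proof eventually_elim
    case (elim n)
    have "1 \<le> real n" using elim(2) by linarith
    then have "\<exists>\<Gamma>\<in>plans (add_mset u (grid n)) (add_mset v (grid n)). plan_cost p \<Gamma> \<le> ?e n"
      using p s t elim(2) by (intro grid_plan) auto
    then show ?case using elim(1) by (meson less_imp_le order_trans)
  qed
qed

text \<open>\<open>Q\<close> prescribes which points are traded for each other. Every pair of
  \<open>Q\<close> gets a grid layer of its own, so the paths do not interfere and their costs add
  up.\<close>

lemma layered_plan_eventually:
  assumes p: "1 < p" and "0 < \<eta>" and "Q \<in> plans X Y"
  shows "\<forall>\<^sub>F n in sequentially.
    \<exists>\<Gamma>\<in>plans (X + repeat_mset (size Q) (grid n)) (Y + repeat_mset (size Q) (grid n)).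
      plan_cost p \<Gamma> \<le> (\<Sum>x\<in>#X. dist_diagonal x powr p) + (\<Sum>y\<in>#Y. dist_diagonal y powr p) + \<eta>"
  using assms(2,3)
proof (induction Q arbitrary: X Y \<eta>)
  case empty
  then show ?case by (intro always_eventually allI bexI[of _ "{#}"]) (auto simp: plans_def)
next
  case (add z Q)
  let ?X = "image_mset fst Q" and ?Y = "image_mset snd Q"
  have XY: "X = add_mset (fst z) ?X" "Y = add_mset (snd z) ?Y" using add.prems by (auto simp: plans_def)
  have "0 < \<eta> / 2" "Q \<in> plans ?X ?Y" using add.prems by (auto simp: plans_def)
  from add.IH[OF this] grid_plan_eventually[OF p this(1), of "fst z" "snd z"]
  show ?case
  proof eventually_elim
    case (elim n)
    then obtain \<Gamma> \<Gamma>' where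
      1: "\<Gamma> \<in> plans (?X + repeat_mset (size Q) (grid n)) (?Y + repeat_mset (size Q) (grid n))"
      "plan_cost p \<Gamma> \<le> (\<Sum>x\<in>#?X. dist_diagonal x powr p) + (\<Sum>y\<in>#?Y. dist_diagonal y powr p) + \<eta> / 2"
      and 2: "\<Gamma>' \<in> plans (add_mset (fst z) (grid n)) (add_mset (snd z) (grid n))"
      "plan_cost p \<Gamma>' \<le> dist_diagonal (fst z) powr p + dist_diagonal (snd z) powr p + \<eta> / 2"
      by blast
    have "\<Gamma> + \<Gamma>' \<in> plans (X + repeat_mset (size (add_mset z Q)) (grid n)) (Y + repeat_mset (size (add_mset z Q)) (grid n))"
      using plans_add[OF 1(1) 2(1)] by (simp add: XY add_ac)
    moreover have "plan_cost p (\<Gamma> + \<Gamma>') \<le> (\<Sum>x\<in>#X. dist_diagonal x powr p) + (\<Sum>y\<in>#Y. dist_diagonal y powr p) + \<eta>"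
      using 1(2) 2(2) by (simp add: XY)
    ultimately show ?case by blast
  qed
qed

section \<open>Padding diagrams to a common size\<close>

text \<open>The origins bring every diagram of size at most \<open>m\<close> to size
  \<open>m\<close>; they lie on the diagonal, so leaving them unmatched is free. With
  \<open>m\<close> layers there is one for each pair that may have to be traded.\<close>

definition padding :: "nat \<Rightarrow> nat \<Rightarrow> diagram \<Rightarrow> diagram" where
  "padding m n A = replicate_mset (m - size A) 0 + repeat_mset m (grid n)"

lemma set_padding_subset_diagonal: "set_mset (padding m n A) \<subseteq> diagonal"
proof -
  have "set_mset (repeat_mset m (grid n)) \<subseteq> set_mset (grid n)"
    by (induction m) auto
  then show ?thesis
    using set_grid_subset_diagonal[of n] by (auto simp: padding_def diagonal_iff split: if_splits)
qed

lemma size_add_padding: "size A \<le> m \<Longrightarrow> size (A + padding m n A) = m * (size (grid n) + 1)"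
  by (simp add: padding_def)

text \<open>Matched points follow the matching; unmatched points and added origins are traded
  through one layer per pair; the other \<open>size A1\<close> layers stay in place.\<close>

lemma padded_plan_eventually:
  assumes p: "1 < p" and \<eta>: "0 < \<eta>" and size: "size A \<le> m" "size B \<le> m"
    and M: "M \<in> partial_matchings A B"
  shows "\<forall>\<^sub>F n in sequentially. \<exists>\<Gamma>\<in>plans (A + padding m n A) (B + padding m n B).
    plan_cost p \<Gamma> \<le> matching_cost p A B M powr p + \<eta>"
proof -
  obtain A1 B1 f where Mf: "M = (A1, B1, f)" by (cases M)
  then have sub: "A1 \<subseteq># A" "B1 \<subseteq># B" and f: "bij_betw f (copies A1) (copies B1)"
    using M by (auto simp: partial_matchings_def)
  have size1: "size A1 = size B1" using bij_betw_same_card[OF f] by (simp add: card_copies)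
  obtain \<Gamma>0 where \<Gamma>0: "\<Gamma>0 \<in> plans A1 B1"
    "plan_cost p \<Gamma>0 = (\<Sum>x\<in>copies A1. linf_dist (fst x) (fst (f x)) powr p)"
    using plan_of_bij_copies[OF f, of "\<lambda>x y. linf_dist x y powr p"] by (auto simp: plan_cost_def)
  obtain A' B' where A': "A = A1 + A'" and B': "B = B1 + B'"
    using sub by (auto simp: mset_subset_eq_exists_conv)
  define X where "X = A' + replicate_mset (m - size A) 0"
  have "size X = size A' + (m - size A)" by (simp only: X_def size_union size_replicate_mset)
  then have sizeX: "size X = m - size A1"
    using size(1) by (simp add: A')
  define Y where "Y = B' + replicate_mset (m - size B) 0"
  have "size Y = size B' + (m - size B)" by (simp only: Y_def size_union size_replicate_mset)
  then have sizeY: "size Y = m - size A1"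
    using size(2) by (simp add: B' size1)
  have zero: "dist_diagonal 0 = 0" by (intro dist_diagonal_eq_0) (simp add: diagonal_iff)
  have cost: "matching_cost p A B M powr p = plan_cost p \<Gamma>0
      + ((\<Sum>x\<in>#X. dist_diagonal x powr p) + (\<Sum>y\<in>#Y. dist_diagonal y powr p))"
    using p by (simp add: matching_cost_def Mf A' B' \<Gamma>0(2)[symmetric] X_def Y_def zero powr_powr
      plan_cost_nonneg sum_mset_powr_nonneg)
  \<comment> \<open>Any pairing of \<open>X\<close> with \<open>Y\<close> will do, since the bound
    for layered plans involves only the distances to the diagonal.\<close>
  obtain Q where Q: "Q \<in> plans X Y" using plans_nonempty[of X Y] sizeX sizeY by auto
  have sizeQ: "size Q = m - size A1"
    using Q sizeX by (auto simp: plans_def)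
  have A1m: "size A1 \<le> m" using size_mset_mono[OF sub(1)] size(1) by simp
  have rep: "repeat_mset m G = repeat_mset (m - size A1) G + repeat_mset (size A1) G" for G :: diagram
    using A1m by (intro multiset_eqI) (simp flip: add_mult_distrib)
  have decA: "A + padding m n A = (X + repeat_mset (size Q) (grid n)) + A1 + repeat_mset (size A1) (grid n)" for n
    by (simp only: padding_def rep[of "grid n"] X_def sizeQ A' add_ac)
  have decB: "B + padding m n B = (Y + repeat_mset (size Q) (grid n)) + B1 + repeat_mset (size A1) (grid n)" for n
    by (simp only: padding_def rep[of "grid n"] Y_def sizeQ B' add_ac)
  from layered_plan_eventually[OF p \<eta> Q]
  show ?thesis
  proof eventually_elim
    case (elim n)
    then obtain \<Gamma>1 where \<Gamma>1:
      "\<Gamma>1 \<in> plans (X + repeat_mset (size Q) (grid n)) (Y + repeat_mset (size Q) (grid n))"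
      "plan_cost p \<Gamma>1 \<le> (\<Sum>x\<in>#X. dist_diagonal x powr p) + (\<Sum>y\<in>#Y. dist_diagonal y powr p) + \<eta>"
      by blast
    obtain \<Gamma>2 where \<Gamma>2: "\<Gamma>2 \<in> plans (repeat_mset (size A1) (grid n)) (repeat_mset (size A1) (grid n))"
      "plan_cost p \<Gamma>2 = 0" using plans_refl by blast
    have "\<Gamma>1 + \<Gamma>0 + \<Gamma>2 \<in> plans (A + padding m n A) (B + padding m n B)"
      unfolding decA decB by (intro plans_add \<Gamma>0 \<Gamma>1 \<Gamma>2)
    moreover have "plan_cost p (\<Gamma>1 + \<Gamma>0 + \<Gamma>2) \<le> matching_cost p A B M powr p + \<eta>"
      using \<Gamma>1(2) \<Gamma>2(2) cost by simp
    ultimately show ?case by blast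
  qed
qed

subsection \<open>Uniform measures on multisets\<close>

lemma sum_copies_count: "(\<Sum>z\<in>copies A. h (fst z)) = (\<Sum>x\<in>set_mset A. real (count A x) * h x)"
proof -
  have "copies A = Sigma (set_mset A) (\<lambda>x. {..<count A x})"
    by (auto simp: copies_def simp flip: count_greater_zero_iff)
  moreover have "(\<Sum>x\<in>set_mset A. \<Sum>k<count A x. h x)
      = (\<Sum>(x, k)\<in>Sigma (set_mset A) (\<lambda>x. {..<count A x}). h x)"
    by (rule sum.Sigma) auto
  ultimately have "(\<Sum>z\<in>copies A. h (fst z)) = (\<Sum>x\<in>set_mset A. \<Sum>k<count A x. h x)"
    by (simp add: case_prod_unfold)
  then show ?thesis by simp
qed

text \<open>Drawing a copy uniformly gives every point its multiplicity as weight. The map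
  \<open>g\<close> performs the dilation, on points for the measures and on pairs for their
  couplings.\<close>

definition mset_measure :: "('a \<Rightarrow> 'b::topological_space) \<Rightarrow> 'a multiset \<Rightarrow> 'b measure" where
  "mset_measure g A = distr (measure_pmf (pmf_of_set (copies A))) borel (\<lambda>x. g (fst x))"

lemma prob_space_mset_measure: "prob_space (mset_measure g A)"
  unfolding mset_measure_def by (rule measure_pmf.prob_space_distr) simp

lemma sets_mset_measure [simp, measurable_cong]: "sets (mset_measure g A) = sets borel"
  by (simp add: mset_measure_def)

lemma nn_integral_mset_measure:
  assumes "A \<noteq> {#}" "f \<in> borel_measurable borel"
  shows "(\<integral>\<^sup>+ x. f x \<partial>mset_measure g A) = (\<Sum>x\<in>#A. f (g x)) / of_nat (size A)"
proof -
  have "copies A \<noteq> {}" using assms(1) card_copies[of A] by auto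
  then show ?thesis
    using assms(2) by (simp add: mset_measure_def nn_integral_distr nn_integral_pmf_of_set card_copies
        sum_copies[of "\<lambda>x. f (g x)"])
qed

lemma emeasure_mset_measure:
  assumes "A \<noteq> {#}" "S \<in> sets borel"
  shows "emeasure (mset_measure g A) S = (\<Sum>x\<in>#A. indicator S (g x)) / of_nat (size A)"
  using nn_integral_mset_measure[OF assms(1), of "indicator S" g] assms(2) by simp

lemma mset_measure_image_mset:
  assumes "A \<noteq> {#}"
  shows "mset_measure g (image_mset h A) = mset_measure (\<lambda>x. g (h x)) A"
  using assms by (intro measure_eqI) (auto simp: emeasure_mset_measure multiset.map_comp comp_def)

lemma distr_mset_measure:
  assumes "h \<in> borel_measurable borel"
  shows "distr (mset_measure g A) borel h = mset_measure (\<lambda>x. h (g x)) A"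
  unfolding mset_measure_def using assms by (subst distr_distr) (auto simp: comp_def)

lemma measure_mset_measure_singleton:
  fixes g :: "'a \<Rightarrow> 'b::t2_space"
  assumes "A \<noteq> {#}" "inj g"
  shows "measure (mset_measure g A) {g x} = count A x / size A"
proof -
  have "(\<Sum>y\<in>#A. indicator {g x} (g y) :: ennreal) = of_nat (count A x)"
    using assms(2) by (induction A) (auto simp: inj_eq indicator_def)
  then have "emeasure (mset_measure g A) {g x} = ennreal (count A x / size A)"
    using assms(1) by (simp add: emeasure_mset_measure ennreal_of_nat_eq_real_of_nat divide_ennreal
        nonempty_has_size)
  then show ?thesis by (simp add: measure_def)
qed

lemma measure_mset_measure_Compl:
  fixes g :: "'a \<Rightarrow> 'b::t2_space"
  assumes "A \<noteq> {#}"
  shows "measure (mset_measure g A) (- g ` set_mset A) = 0"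
proof -
  have "closed (g ` set_mset A)" by (simp add: finite_imp_closed)
  then have "emeasure (mset_measure g A) (- g ` set_mset A)
      = (\<Sum>y\<in>#A. indicator (- g ` set_mset A) (g y)) / of_nat (size A)"
    using assms by (intro emeasure_mset_measure) auto
  also have "(\<Sum>y\<in>#A. indicator (- g ` set_mset A) (g y) :: ennreal) = (\<Sum>y\<in>#A. 0)"
    by (intro arg_cong[of _ _ sum_mset] image_mset_cong) (simp add: indicator_def)
  finally show ?thesis
    by (simp add: measure_def)
qed

lemma linf_dist_measurable [measurable]:
  "(\<lambda>(x, y). linf_dist x y) \<in> borel_measurable borel"
  unfolding linf_dist_def case_prod_unfold
  by (intro borel_measurable_continuous_onI continuous_intros)

lemma linf_cost_measurable [measurable]:
  "(\<lambda>(x, y). ennreal (linf_dist x y powr p)) \<in> borel_measurable borel"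
  using linf_dist_measurable unfolding case_prod_unfold by measurable

lemma mset_measure_in_wasserstein_space:
  assumes "A \<noteq> {#}"
  shows "mset_measure g A \<in> wasserstein_space p"
proof -
  have [measurable]: "(\<lambda>x. linf_dist x 0) \<in> borel_measurable borel"
    unfolding linf_dist_def by (intro borel_measurable_continuous_onI continuous_intros)
  have "(\<lambda>x. ennreal (linf_dist x 0 powr p)) \<in> borel_measurable borel"
    by measurable
  moreover have "(\<Sum>x\<in>#A. ennreal (linf_dist (g x) 0 powr p)) < \<infinity>"
    by (induction A) auto
  ultimately have "(\<integral>\<^sup>+ x. ennreal (linf_dist x 0 powr p) \<partial>mset_measure g A) < \<infinity>"
    using assms by (simp add: nn_integral_mset_measure ennreal_divide_eq_top_iff less_top[symmetric])
  then show ?thesis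
    by (simp add: wasserstein_space_def prob_space_mset_measure)
qed

text \<open>Bounds the cost of a coupling from below by the part carried by finitely many atoms, so
  it need not be shown that these carry all the mass.\<close>

lemma sum_le_nn_integral:
  fixes f :: "'a::t2_space \<Rightarrow> ennreal"
  assumes "finite F" "sets \<gamma> = sets borel"
  shows "(\<Sum>z\<in>F. f z * emeasure \<gamma> {z}) \<le> (\<integral>\<^sup>+ z. f z \<partial>\<gamma>)"
proof -
  have "(\<Sum>z\<in>F. f z * emeasure \<gamma> {z}) = (\<integral>\<^sup>+ z. (\<Sum>a\<in>F. f a * indicator {a} z) \<partial>\<gamma>)"
    using assms(2) by (subst nn_integral_sum) (auto simp: nn_integral_cmult_indicator)
  also have "\<dots> \<le> (\<integral>\<^sup>+ z. f z \<partial>\<gamma>)"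
  proof (rule nn_integral_mono)
    fix z
    have "(\<Sum>a\<in>F. f a * indicator {a} z) = (\<Sum>a\<in>F. if a = z then f a else 0)"
      by (intro sum.cong) (auto simp: indicator_def)
    then show "(\<Sum>a\<in>F. f a * indicator {a} z) \<le> f z"
      using assms(1) by simp
  qed
  finally show ?thesis .
qed

text \<open>Outside a null set \<open>\<psi>\<close> takes values in \<open>T\<close>, so its fibres
  over \<open>T\<close> partition the event that \<open>\<phi>\<close> equals \<open>x\<close>. With
  the two projections, in either order, this yields the row and column sums of a coupling.\<close>

lemma sum_measure_fibres:
  fixes \<phi> \<psi> :: "'a \<Rightarrow> 'b::t2_space"
  assumes "prob_space \<gamma>" and meas: "\<phi> \<in> borel_measurable \<gamma>" "\<psi> \<in> borel_measurable \<gamma>"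
    and T: "finite T" "measure (distr \<gamma> borel \<psi>) (- T) = 0"
  shows "(\<Sum>y\<in>T. measure \<gamma> {z \<in> space \<gamma>. \<phi> z = x \<and> \<psi> z = y}) = measure (distr \<gamma> borel \<phi>) {x}"
proof -
  interpret prob_space \<gamma> by fact
  have clT: "closed T" using T(1) by (rule finite_imp_closed)
  have m1: "{z \<in> space \<gamma>. \<phi> z = x} \<in> sets \<gamma>"
    using measurable_sets[OF meas(1), of "{x}"] by (simp add: vimage_def Int_def conj_commute)
  have m2: "{z \<in> space \<gamma>. \<psi> z = y} \<in> sets \<gamma>" for y
    using measurable_sets[OF meas(2), of "{y}"] by (simp add: vimage_def Int_def conj_commute)
  have m3: "{z \<in> space \<gamma>. \<psi> z \<notin> T} \<in> sets \<gamma>"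
    using measurable_sets[OF meas(2), of "- T"] clT
    by (simp add: vimage_def Int_def conj_commute borel_open open_Compl)
  have m12: "{z \<in> space \<gamma>. \<phi> z = x \<and> \<psi> z = y} \<in> sets \<gamma>" for y
    using sets.Int[OF m1 m2[of y]] by (auto simp: Int_def conj_ac elim: back_subst[of "\<lambda>S. S \<in> sets \<gamma>"])
  have null: "{z \<in> space \<gamma>. \<psi> z \<notin> T} \<in> null_sets \<gamma>"
    using T(2) m3 clT meas(2)
    by (auto simp: null_sets_def emeasure_eq_measure measure_distr borel_open open_Compl vimage_def
        Int_def conj_commute)
  have "(\<Sum>y\<in>T. measure \<gamma> {z \<in> space \<gamma>. \<phi> z = x \<and> \<psi> z = y})
      = measure \<gamma> (\<Union>y\<in>T. {z \<in> space \<gamma>. \<phi> z = x \<and> \<psi> z = y})"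
    using T(1) m12 by (intro finite_measure_finite_Union[symmetric]) (auto simp: disjoint_family_on_def)
  also have "(\<Union>y\<in>T. {z \<in> space \<gamma>. \<phi> z = x \<and> \<psi> z = y})
      = {z \<in> space \<gamma>. \<phi> z = x} - {z \<in> space \<gamma>. \<psi> z \<notin> T}" by auto
  also have "measure \<gamma> \<dots> = measure \<gamma> {z \<in> space \<gamma>. \<phi> z = x}"
    by (rule measure_Diff_null_set[OF m1 null])
  also have "\<dots> = measure (distr \<gamma> borel \<phi>) {x}"
    using meas(1) by (simp add: measure_distr vimage_def Int_def conj_commute)
  finally show ?thesis .
qed

section \<open>Couplings of dilated uniform measures versus plans\<close>

context
  fixes p :: real and s :: real and N :: nat and A B :: diagram
  assumes p: "0 < p" and N: "0 < N" and s_def: "s = real N powr (1 / p)"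
    and sizeA: "size A = N" and sizeB: "size B = N"
begin

private lemma nonempty: "A \<noteq> {#}" "B \<noteq> {#}"
  using N sizeA sizeB by auto

private lemma cost_scale: "linf_dist (s *\<^sub>R x) (s *\<^sub>R y) powr p = real N * linf_dist x y powr p"
  using p N by (simp add: s_def linf_dist_scaleR powr_mult linf_dist_nonneg powr_powr)

text \<open>The uniform measure on the dilated pairs of the plan is a coupling, and the factor
  \<open>N\<close> from the dilation cancels the weight \<open>1 / N\<close> of a pair.\<close>

lemma coupling_of_plan:
  assumes \<Gamma>: "\<Gamma> \<in> plans A B"
  shows "\<exists>\<gamma>\<in>couplings (mset_measure ((*\<^sub>R) s) A) (mset_measure ((*\<^sub>R) s) B).
    (\<integral>\<^sup>+ (x, y). ennreal (linf_dist x y powr p) \<partial>\<gamma>) = ennreal (plan_cost p \<Gamma>)"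
proof
  let ?\<gamma> = "mset_measure (\<lambda>z. (s *\<^sub>R fst z, s *\<^sub>R snd z)) \<Gamma>"
  have \<Gamma>': "image_mset fst \<Gamma> = A" "image_mset snd \<Gamma> = B" using \<Gamma> by (auto simp: plans_def)
  have ne: "\<Gamma> \<noteq> {#}" using \<Gamma>' nonempty by auto
  have sz: "size \<Gamma> = N" using \<Gamma>'(1) sizeA by auto
  have "distr ?\<gamma> borel fst = mset_measure ((*\<^sub>R) s) A"
    "distr ?\<gamma> borel snd = mset_measure ((*\<^sub>R) s) B"
    using ne unfolding \<Gamma>'[symmetric]
    by (simp_all add: distr_mset_measure mset_measure_image_mset borel_measurable_continuous_onI
        continuous_on_fst continuous_on_snd)
  then show "?\<gamma> \<in> couplings (mset_measure ((*\<^sub>R) s) A) (mset_measure ((*\<^sub>R) s) B)"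
    by (simp add: couplings_def prob_space_mset_measure)
  have "(\<Sum>z\<in>#\<Gamma>. ennreal (linf_dist (s *\<^sub>R fst z) (s *\<^sub>R snd z) powr p)) = ennreal (real N * plan_cost p \<Gamma>)"
    by (induction \<Gamma>) (auto simp: cost_scale distrib_left plan_cost_nonneg)
  then show "(\<integral>\<^sup>+ (x, y). ennreal (linf_dist x y powr p) \<partial>?\<gamma>) = ennreal (plan_cost p \<Gamma>)"
    using N ne by (simp add: nn_integral_mset_measure sz ennreal_of_nat_eq_real_of_nat divide_ennreal
        plan_cost_nonneg)
qed

text \<open>The atoms of the coupling, spread over the copies, form a matrix whose rows and columns
  all sum to \<open>1 / N\<close>. Some bijection of the copies costs no more than this
  matrix.\<close>

lemma plan_of_coupling:
  assumes \<gamma>: "\<gamma> \<in> couplings (mset_measure ((*\<^sub>R) s) A) (mset_measure ((*\<^sub>R) s) B)"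
  shows "\<exists>\<Gamma>\<in>plans A B. ennreal (plan_cost p \<Gamma>) \<le> (\<integral>\<^sup>+ (x, y). ennreal (linf_dist x y powr p) \<partial>\<gamma>)"
proof -
  have prob: "prob_space \<gamma>" and sets: "sets \<gamma> = sets borel"
    and marg: "distr \<gamma> borel fst = mset_measure ((*\<^sub>R) s) A" "distr \<gamma> borel snd = mset_measure ((*\<^sub>R) s) B"
    using \<gamma> by (auto simp: couplings_def)
  interpret prob_space \<gamma> by fact
  have space: "space \<gamma> = UNIV" using sets_eq_imp_space_eq[OF sets] by simp
  have "s \<noteq> 0" using N p by (simp add: s_def)
  then have inj: "inj ((*\<^sub>R) s :: real \<times> real \<Rightarrow> real \<times> real)" by (simp add: inj_on_def)
  have meas: "fst \<in> borel_measurable \<gamma>" "snd \<in> borel_measurable \<gamma>"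
    unfolding measurable_cong_sets[OF sets refl]
    by (auto intro!: borel_measurable_continuous_onI continuous_intros)
  define w where "w x y = measure \<gamma> {(s *\<^sub>R x, s *\<^sub>R y)}" for x y
  have row: "(\<Sum>y\<in>set_mset B. w x y) = count A x / N" for x
  proof -
    have "(\<Sum>y\<in>set_mset B. w x y) = (\<Sum>y\<in>(*\<^sub>R) s ` set_mset B. measure \<gamma> {z \<in> space \<gamma>. fst z = s *\<^sub>R x \<and> snd z = y})"
      using inj by (subst sum.reindex) (auto simp: w_def space inj_on_def prod_eq_iff[symmetric]
          intro!: sum.cong arg_cong[of _ _ "measure \<gamma>"])
    also have "\<dots> = measure (mset_measure ((*\<^sub>R) s) A) {s *\<^sub>R x}"
      using measure_mset_measure_Compl[OF nonempty(2)]
      by (subst sum_measure_fibres[OF prob meas]) (simp_all add: marg)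
    finally show ?thesis
      using measure_mset_measure_singleton[OF nonempty(1) inj] sizeA by simp
  qed
  have col: "(\<Sum>x\<in>set_mset A. w x y) = count B y / N" for y
  proof -
    have "(\<Sum>x\<in>set_mset A. w x y) = (\<Sum>x\<in>(*\<^sub>R) s ` set_mset A. measure \<gamma> {z \<in> space \<gamma>. snd z = s *\<^sub>R y \<and> fst z = x})"
      using inj by (subst sum.reindex) (auto simp: w_def space inj_on_def prod_eq_iff[symmetric]
          intro!: sum.cong arg_cong[of _ _ "measure \<gamma>"])
    also have "\<dots> = measure (mset_measure ((*\<^sub>R) s) B) {s *\<^sub>R y}"
      using measure_mset_measure_Compl[OF nonempty(1)]
      by (subst sum_measure_fibres[OF prob meas(2,1)]) (simp_all add: marg)
    finally show ?thesis
      using measure_mset_measure_singleton[OF nonempty(2) inj] sizeB by simp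
  qed
  \<comment> \<open>The mass of each atom is shared equally among all pairs of copies of its two
    points.\<close>
  define M where "M i j = w (fst i) (fst j) / (count A (fst i) * count B (fst j))"
    for i j :: "(real \<times> real) \<times> nat"
  define c where "c i j = real N * linf_dist (fst i) (fst j) powr p" for i j :: "(real \<times> real) \<times> nat"
  have sum_B: "(\<Sum>j\<in>copies B. w x (fst j) / (a * count B (fst j)) * h (fst j)) = (\<Sum>y\<in>set_mset B. w x y * h y) / a"
    for x a and h :: "real \<times> real \<Rightarrow> real"
    unfolding sum_copies_count[of "\<lambda>y. w x y / (a * count B y) * h y"] sum_divide_distrib
    by (intro sum.cong) (auto simp: field_simps count_eq_zero_iff)
  have sum_A: "(\<Sum>i\<in>copies A. h (fst i) / count A (fst i)) = (\<Sum>x\<in>set_mset A. h x)" for h :: "real \<times> real \<Rightarrow> real"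
    unfolding sum_copies_count[of "\<lambda>x. h x / count A x"]
    by (intro sum.cong) auto
  have rowM: "(\<Sum>j\<in>copies B. M i j) = 1 / N" if "i \<in> copies A" for i
    using that sum_B[of "fst i" "count A (fst i)" "\<lambda>_. 1"] row[of "fst i"]
    by (auto simp: M_def copies_def)
  have colM: "(\<Sum>i\<in>copies A. M i j) = 1 / N" if "j \<in> copies B" for j
    using that sum_A[of "\<lambda>x. w x (fst j) / count B (fst j)"] col[of "fst j"]
    by (auto simp: M_def copies_def field_simps simp flip: sum_divide_distrib)
  obtain \<sigma> where \<sigma>: "bij_betw \<sigma> (copies A) (copies B)"
    "1 / N * (\<Sum>i\<in>copies A. c i (\<sigma> i)) \<le> (\<Sum>i\<in>copies A. \<Sum>j\<in>copies B. M i j * c i j)"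
    using bij_cost_le_bistochastic[of "copies A" "copies B" M "1 / N" c] rowM colM
    by (auto simp: card_copies sizeA sizeB M_def w_def)
  obtain \<Gamma> where \<Gamma>: "\<Gamma> \<in> plans A B"
    "plan_cost p \<Gamma> = (\<Sum>i\<in>copies A. linf_dist (fst i) (fst (\<sigma> i)) powr p)"
    using plan_of_bij_copies[OF \<sigma>(1), of "\<lambda>x y. linf_dist x y powr p"] by (auto simp: plan_cost_def)
  have "plan_cost p \<Gamma> = 1 / N * (\<Sum>i\<in>copies A. c i (\<sigma> i))"
    using N by (simp add: \<Gamma>(2) c_def flip: sum_distrib_left)
  also note \<sigma>(2)
  also have "(\<Sum>i\<in>copies A. \<Sum>j\<in>copies B. M i j * c i j)
      = (\<Sum>i\<in>copies A. (\<Sum>y\<in>set_mset B. w (fst i) y * (real N * linf_dist (fst i) y powr p)) / count A (fst i))"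
    unfolding M_def c_def using sum_B by (intro sum.cong refl) simp
  also have "\<dots> = (\<Sum>x\<in>set_mset A. \<Sum>y\<in>set_mset B. w x y * (real N * linf_dist x y powr p))"
    by (rule sum_A)
  also have "\<dots> = (\<Sum>(x, y)\<in>set_mset A \<times> set_mset B. w x y * linf_dist (s *\<^sub>R x) (s *\<^sub>R y) powr p)"
    by (simp add: sum.cartesian_product cost_scale)
  finally have "ennreal (plan_cost p \<Gamma>)
      \<le> (\<Sum>(x, y)\<in>set_mset A \<times> set_mset B. ennreal (w x y * linf_dist (s *\<^sub>R x) (s *\<^sub>R y) powr p))"
    by (subst (asm) ennreal_le_iff[symmetric])
      (auto simp: w_def case_prod_unfold sum_nonneg sum_ennreal)
  also have "\<dots> = (\<Sum>z\<in>(\<lambda>(x, y). (s *\<^sub>R x, s *\<^sub>R y)) ` (set_mset A \<times> set_mset B).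
      (case z of (x, y) \<Rightarrow> ennreal (linf_dist x y powr p)) * emeasure \<gamma> {z})"
    using inj by (subst sum.reindex)
      (auto simp: inj_on_def w_def emeasure_eq_measure ennreal_mult mult.commute intro!: sum.cong)
  also have "\<dots> \<le> (\<integral>\<^sup>+ (x, y). ennreal (linf_dist x y powr p) \<partial>\<gamma>)"
    by (rule sum_le_nn_integral) (auto simp: sets)
  finally show ?thesis using \<Gamma>(1) by blast
qed

lemma wasserstein_measure_le:
  assumes "\<Gamma> \<in> plans A B"
  shows "wasserstein_measure p (mset_measure ((*\<^sub>R) s) A) (mset_measure ((*\<^sub>R) s) B) \<le> plan_cost p \<Gamma> powr (1 / p)"
proof -
  from coupling_of_plan[OF assms]
  have "(INF \<gamma>\<in>couplings (mset_measure ((*\<^sub>R) s) A) (mset_measure ((*\<^sub>R) s) B).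
      \<integral>\<^sup>+ (x, y). ennreal (linf_dist x y powr p) \<partial>\<gamma>) \<le> ennreal (plan_cost p \<Gamma>)"
    by (metis INF_lower)
  then show ?thesis
    unfolding wasserstein_measure_def using p
    by (intro powr_mono2) (auto intro: enn2real_leI plan_cost_nonneg)
qed

lemma wasserstein_measure_ge:
  assumes "\<And>\<Gamma>. \<Gamma> \<in> plans A B \<Longrightarrow> c \<le> plan_cost p \<Gamma>" and "0 \<le> c"
  shows "c powr (1 / p) \<le> wasserstein_measure p (mset_measure ((*\<^sub>R) s) A) (mset_measure ((*\<^sub>R) s) B)"
proof -
  let ?I = "INF \<gamma>\<in>couplings (mset_measure ((*\<^sub>R) s) A) (mset_measure ((*\<^sub>R) s) B).
      \<integral>\<^sup>+ (x, y). ennreal (linf_dist x y powr p) \<partial>\<gamma>"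
  \<comment> \<open>Since \<open>enn2real\<close> sends \<open>\<top>\<close> to \<open>0\<close>, a
    lower bound passes through it only once the infimum is known to be finite; any plan shows
    this.\<close>
  obtain \<Gamma> where "\<Gamma> \<in> plans A B" using plans_nonempty[of A B] sizeA sizeB by auto
  from coupling_of_plan[OF this] have "?I \<le> ennreal (plan_cost p \<Gamma>)"
    by (metis INF_lower)
  then have fin: "?I < \<top>" using ennreal_less_top order_le_less_trans by blast
  have "ennreal c \<le> ?I"
  proof (rule INF_greatest)
    fix \<gamma> assume "\<gamma> \<in> couplings (mset_measure ((*\<^sub>R) s) A) (mset_measure ((*\<^sub>R) s) B)"
    from plan_of_coupling[OF this] obtain \<Gamma> where "\<Gamma> \<in> plans A B"
      "ennreal (plan_cost p \<Gamma>) \<le> (\<integral>\<^sup>+ (x, y). ennreal (linf_dist x y powr p) \<partial>\<gamma>)" by blast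
    then show "ennreal c \<le> (\<integral>\<^sup>+ (x, y). ennreal (linf_dist x y powr p) \<partial>\<gamma>)"
      using assms(1) ennreal_leI order_trans by blast
  qed
  then have "c \<le> enn2real ?I"
    using fin enn2real_mono[of "ennreal c" ?I] assms(2) by simp
  then show ?thesis
    unfolding wasserstein_measure_def using p assms(2) by (intro powr_mono2) auto
qed

end

section \<open>The quasi-isometric embedding\<close>

text \<open>A matching that comes within \<open>\<epsilon>\<close> of the infimum leaves a positive
  gap between the \<open>p\<close>-th powers, and this gap serves as the error allowed to the padded
  plan.\<close>

lemma padded_plan_eventually_le:
  assumes p: "1 < p" and \<epsilon>: "0 < \<epsilon>" and size: "size A \<le> m" "size B \<le> m"
  shows "\<forall>\<^sub>F n in sequentially. \<exists>\<Gamma>\<in>plans (A + padding m n A) (B + padding m n B).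
    plan_cost p \<Gamma> \<le> (wasserstein_diagram p A B + \<epsilon>) powr p"
proof -
  obtain M where M: "M \<in> partial_matchings A B"
    "matching_cost p A B M < wasserstein_diagram p A B + \<epsilon>"
    using cInf_lessD[of "matching_cost p A B ` partial_matchings A B" "wasserstein_diagram p A B + \<epsilon>"]
      partial_matchings_nonempty \<epsilon> by (auto simp: wasserstein_diagram_def)
  have "0 \<le> matching_cost p A B M" by (cases M) (simp add: matching_cost_def)
  then have "matching_cost p A B M powr p < (wasserstein_diagram p A B + \<epsilon>) powr p"
    using M(2) p by (intro powr_less_mono2) auto
  from padded_plan_eventually[OF p _ size M(1), of "(wasserstein_diagram p A B + \<epsilon>) powr p - matching_cost p A B M powr p"] this
  show ?thesis by simp
qed

theorem proposition22:
  fixes p :: real and D :: "diagram set"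
  assumes "1 < p" and "finite D" and "D \<subseteq> diagrams"
  shows "\<forall>\<epsilon>>0. \<exists>f. f ` D \<subseteq> wasserstein_space p \<and>
    (\<forall>A\<in>D. \<forall>B\<in>D.
      wasserstein_diagram p A B - \<epsilon> \<le> wasserstein_measure p (f A) (f B) \<and>
      wasserstein_measure p (f A) (f B) \<le> wasserstein_diagram p A B + \<epsilon>)"
proof (intro allI impI)
  fix \<epsilon> :: real assume \<epsilon>: "0 < \<epsilon>"
  \<comment> \<open>The successor keeps \<open>m\<close> positive even if all diagrams are empty, so
    that the padded multisets are never empty.\<close>
  obtain m where m: "0 < m" "\<And>A. A \<in> D \<Longrightarrow> size A \<le> m"
  proof
    show "0 < Suc (Max (size ` D))" by simp
    show "size A \<le> Suc (Max (size ` D))" if "A \<in> D" for A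
      using that assms(2) by (intro le_SucI Max_ge) auto
  qed
  \<comment> \<open>Finiteness of \<open>D\<close> makes one \<open>n\<close> serve all pairs of
    diagrams at once.\<close>
  have "\<forall>\<^sub>F n in sequentially. \<forall>A\<in>D. \<forall>B\<in>D. \<exists>\<Gamma>\<in>plans (A + padding m n A) (B + padding m n B).
      plan_cost p \<Gamma> \<le> (wasserstein_diagram p A B + \<epsilon>) powr p"
    using assms(1,2) \<epsilon> m(2) by (intro eventually_ball_finite ballI padded_plan_eventually_le) auto
  then obtain n where n: "\<And>A B. A \<in> D \<Longrightarrow> B \<in> D \<Longrightarrow>
      \<exists>\<Gamma>\<in>plans (A + padding m n A) (B + padding m n B). plan_cost p \<Gamma> \<le> (wasserstein_diagram p A B + \<epsilon>) powr p"
    unfolding eventually_sequentially by blast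
  define N where "N = m * (size (grid n) + 1)"
  define s where "s = real N powr (1 / p)"
  define f where "f A = mset_measure ((*\<^sub>R) s) (A + padding m n A)" for A
  have N: "0 < N" using m(1) by (simp add: N_def)
  have size: "size (A + padding m n A) = N" if "A \<in> D" for A
    unfolding N_def using m(2)[OF that] by (rule size_add_padding)
  have p0: "0 < p" using assms(1) by simp
  show "\<exists>f. f ` D \<subseteq> wasserstein_space p \<and>
    (\<forall>A\<in>D. \<forall>B\<in>D.
      wasserstein_diagram p A B - \<epsilon> \<le> wasserstein_measure p (f A) (f B) \<and>
      wasserstein_measure p (f A) (f B) \<le> wasserstein_diagram p A B + \<epsilon>)"
  proof (intro exI[of _ f] conjI ballI)
    show "f ` D \<subseteq> wasserstein_space p"
    proof
      fix \<mu> assume "\<mu> \<in> f ` D"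
      then obtain A where A: "A \<in> D" "\<mu> = f A" by blast
      then have "A + padding m n A \<noteq> {#}" using size[OF A(1)] N by auto
      then show "\<mu> \<in> wasserstein_space p"
        unfolding A(2) f_def by (rule mset_measure_in_wasserstein_space)
    qed
    fix A B assume AB: "A \<in> D" "B \<in> D"
    then have diag: "A \<in> diagrams" "B \<in> diagrams" using assms(3) by auto
    \<comment> \<open>The lower bound holds without any error: every plan between the padded
      diagrams costs at least the \<open>p\<close>-th power of the distance.\<close>
    have "wasserstein_diagram p A B = (wasserstein_diagram p A B powr p) powr (1 / p)"
      using p0 by (simp add: powr_powr wasserstein_diagram_nonneg)
    also have "\<dots> \<le> wasserstein_measure p (f A) (f B)"
      unfolding f_def
      by (rule wasserstein_measure_ge[OF p0 N s_def size[OF AB(1)] size[OF AB(2)]])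
        (auto intro: wasserstein_diagram_le_plan_cost[OF p0 diag set_padding_subset_diagonal set_padding_subset_diagonal])
    finally show "wasserstein_diagram p A B - \<epsilon> \<le> wasserstein_measure p (f A) (f B)"
      using \<epsilon> by simp
    obtain \<Gamma> where \<Gamma>: "\<Gamma> \<in> plans (A + padding m n A) (B + padding m n B)"
      "plan_cost p \<Gamma> \<le> (wasserstein_diagram p A B + \<epsilon>) powr p"
      using n[OF AB] by blast
    have "wasserstein_measure p (f A) (f B) \<le> plan_cost p \<Gamma> powr (1 / p)"
      unfolding f_def
      by (rule wasserstein_measure_le[OF p0 N s_def size[OF AB(1)] size[OF AB(2)] \<Gamma>(1)])
    also have "\<dots> \<le> ((wasserstein_diagram p A B + \<epsilon>) powr p) powr (1 / p)"
      using p0 \<Gamma>(2) by (intro powr_mono2 plan_cost_nonneg) auto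
    also have "\<dots> = wasserstein_diagram p A B + \<epsilon>"
      using p0 \<epsilon> wasserstein_diagram_nonneg[of p A B] by (simp add: powr_powr)
    finally show "wasserstein_measure p (f A) (f B) \<le> wasserstein_diagram p A B + \<epsilon>" .
  qed
qed

end
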